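(* For every integer $n \ge 0$, $$K(P_n) = -\frac{1}{\pi}\int_{-\pi}^{\pi} \frac{\cos(2nx)}{2+\sin^{2}x}\,dx + (-1)^{n}\cos\!\left(2n \sin^{-1}\sqrt{3}\right)\sqrt{\frac{2}{3}}.$$
   Context: $K(P_n)$ denotes the number of Kekulé structures of the $P_2(n)$ benzenoid (pyrenes on a string with hexagons removed from both sides). For the purposes of this statement it is the integer sequence determined by the recurrence $K(P_n) = 10K(P_{n-1}) - K(P_{n-2})$ for $n\ge 2$, with $K(P_0)=0$ and $K(P_1)=4$. Here $\sin^{-1}\sqrt{3}$ denotes the (complex) inverse sine of $\sqrt{3}$, i.e. a complex number $w$ with $\sin w=\sqrt{3}$ (principal value), and $\cos$ is the complex cosine. *)

theory Defs
  imports "HOL-Analysis.Analysis"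
begin

text \<open>The number \<open>K(P\<^sub>n)\<close> of Kekule structures of the benzenoid \<open>P\<^sub>2(n)\<close>,
  taken as the integer sequence given by its recurrence.\<close>

fun kekule_P :: "nat \<Rightarrow> int" where
  "kekule_P 0 = 0"
| "kekule_P (Suc 0) = 4"
| "kekule_P (Suc (Suc n)) = 10 * kekule_P (Suc n) - kekule_P n"

end

theory Submission
  imports Defs
begin

text \<open>Both the integral and \<open>(-1)\<^sup>n cos (2 n w)\<close>, where \<open>sin w = \<surd>3\<close>, satisfy the
  recurrence of \<open>K(P\<^sub>n)\<close>: for the latter because \<open>cos (2 w) = 1 - 2 sin\<^sup>2 w = -5\<close>, and for the
  former because \<open>cos (2 x) = 5 - 2 (2 + sin\<^sup>2 x)\<close>, where the second summand contributes
  a multiple of \<open>\<integral> cos (2 n x) dx\<close>, which vanishes for \<open>n \<ge> 1\<close>. The initial values reduce to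
  the integral of \<open>1 / (2 + sin\<^sup>2 x)\<close>.\<close>

lemma two_plus_sin_sq_pos: "2 + (sin (x::real))\<^sup>2 > 0"
  by (simp add: add_pos_nonneg)

text \<open>The usual primitive \<open>arctan (c tan x)\<close>, with \<open>c = \<surd>6 / 2\<close>, jumps at odd multiples of
  \<open>\<pi> / 2\<close>; by the subtraction formula of arctan it equals \<open>x\<close> plus the smooth arctan below.\<close>

lemma inverse_two_plus_sin_sq_primitive:
  fixes x c :: real
  defines "c \<equiv> sqrt 6 / 2"
  shows "((\<lambda>x. (x + arctan ((c - 1) * (sin x * cos x) / ((cos x)\<^sup>2 + c * (sin x)\<^sup>2))) * (sqrt 6 / 6))
    has_real_derivative 1 / (2 + (sin x)\<^sup>2)) (at x)" (is "(?F has_real_derivative _) _")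
proof -
  define S C where "S = sin x" and "C = cos x"
  define D where "D = C\<^sup>2 + c * S\<^sup>2"
  define u where "u = (c - 1) * (S * C) / D"
  \<comment> \<open>\<open>N\<close> is the numerator that the quotient rule gives for the
    derivative of \<open>u\<close>: \<open>D\<close> itself has derivative
    \<open>2 * (c - 1) * (S * C)\<close>.\<close>
  define N where "N = (c - 1) * ((C\<^sup>2 - S\<^sup>2) * D - S * C * (2 * (c - 1) * (S * C)))"
  have c: "c > 0" "c\<^sup>2 = 3 / 2" "c * sqrt 6 = 3"
    by (simp_all add: c_def power_divide)
  have SC: "S\<^sup>2 + C\<^sup>2 = 1"
    by (simp add: S_def C_def)
  have D: "D > 0"
  proof -
    have "S \<noteq> 0 \<or> C \<noteq> 0" using SC by auto
    then show ?thesis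
      using c(1) by (cases "S = 0") (auto simp: D_def intro!: add_nonneg_pos)
  qed
  have C2: "C\<^sup>2 = 1 - S\<^sup>2"
    using SC by simp
  \<comment> \<open>The mixed terms \<open>2 * c * S^2 * C^2\<close> of the two squares cancel, so
    the sum factors. The choice c^2 = 3/2 makes it half of the target denominator.\<close>
  have q: "D\<^sup>2 + ((c - 1) * (S * C))\<^sup>2 = 1 + S\<^sup>2 / 2"
  proof -
    have "D\<^sup>2 + ((c - 1) * (S * C))\<^sup>2 = (S\<^sup>2 + C\<^sup>2) * (C\<^sup>2 + c\<^sup>2 * S\<^sup>2)"
      by (simp add: D_def power2_eq_square algebra_simps)
    then show ?thesis by (simp add: SC c C2)
  qed
  have N: "N = c * (1 - S\<^sup>2) - (1 - S\<^sup>2) - c\<^sup>2 * S\<^sup>2 + c * S\<^sup>2"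
  proof -
    have "N = (c - 1) * ((S\<^sup>2 + C\<^sup>2) * (C\<^sup>2 - c * S\<^sup>2))"
      by (simp add: N_def D_def power2_eq_square algebra_simps)
    also have "\<dots> = (c - 1) * (1 - S\<^sup>2 - c * S\<^sup>2)"
      unfolding SC by (simp add: C2)
    finally show ?thesis by (simp add: power2_eq_square algebra_simps)
  qed
  have pos: "1 + S\<^sup>2 / 2 > 0"
    by (simp add: add_pos_nonneg)
  have "1 + u\<^sup>2 = (1 + S\<^sup>2 / 2) / D\<^sup>2"
    using D by (simp add: u_def power_divide add_divide_eq_iff flip: q)
  then have "inverse (1 + u\<^sup>2) * (N / D\<^sup>2) = N / (1 + S\<^sup>2 / 2)"
    using D by simp
  \<comment> \<open>Over the common denominator the numerator is \<open>1 + S^2 / 2 + N\<close>, in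
    which everything but \<open>c\<close> cancels.\<close>
  then have "(1 + inverse (1 + u\<^sup>2) * (N / D\<^sup>2)) * (sqrt 6 / 6) = c * sqrt 6 / (6 * (1 + S\<^sup>2 / 2))"
    using pos by (simp add: N c(2) add_divide_eq_iff) (simp add: field_simps)
  also have "\<dots> = 1 / (2 + S\<^sup>2)"
    using pos by (simp add: c(3) divide_simps)
  finally have value_eq: "(1 + inverse (1 + u\<^sup>2) * (N / D\<^sup>2)) * (sqrt 6 / 6) = 1 / (2 + S\<^sup>2)" .
  have quotient: "((\<lambda>x. (c - 1) * (sin x * cos x) / ((cos x)\<^sup>2 + c * (sin x)\<^sup>2)) has_real_derivative N / D\<^sup>2) (at x)"
    using D unfolding N_def D_def S_def C_def
    by (auto intro!: derivative_eq_intros simp: power2_eq_square) (simp add: algebra_simps)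
  have "(?F has_real_derivative (1 + inverse (1 + u\<^sup>2) * (N / D\<^sup>2)) * (sqrt 6 / 6)) (at x)"
    unfolding u_def D_def S_def C_def
    by (rule DERIV_cmult_right DERIV_add DERIV_ident DERIV_chain2[OF DERIV_arctan]
        quotient[unfolded D_def S_def C_def])+
  then show ?thesis
    unfolding value_eq S_def .
qed

lemma integral_inverse_two_plus_sin_sq:
  "integral {-pi..pi} (\<lambda>x::real. 1 / (2 + (sin x)\<^sup>2)) = pi * sqrt (2 / 3)"
proof -
  \<comment> \<open>At both endpoints the sine vanishes, hence so does the arctan term; only the
    linear part of the primitive contributes.\<close>
  have "((\<lambda>x::real. 1 / (2 + (sin x)\<^sup>2)) has_integral pi * (sqrt 6 / 6) - (- pi) * (sqrt 6 / 6)) {-pi..pi}"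
    using fundamental_theorem_of_calculus[OF _ has_vector_derivative_at_within[OF
        inverse_two_plus_sin_sq_primitive[unfolded has_real_derivative_iff_has_vector_derivative]],
        of "-pi" pi]
    by simp
  moreover have "sqrt (2 / 3) = sqrt 6 / 3"
    by (rule real_sqrt_unique) (simp_all add: power_divide)
  ultimately show ?thesis
    by (simp add: integral_unique)
qed

lemma has_integral_cos_even_multiple:
  assumes "n > 0"
  shows "((\<lambda>x::real. cos (2 * real n * x)) has_integral 0) {-pi..pi}"
proof -
  have "((\<lambda>x. sin (2 * real n * x) / (2 * real n)) has_vector_derivative cos (2 * real n * x)) (at x within {-pi..pi})"
    for x :: real
    unfolding has_real_derivative_iff_has_vector_derivative[symmetric]
    using assms by (auto intro!: derivative_eq_intros)
  from fundamental_theorem_of_calculus[OF _ this]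
  have "((\<lambda>x::real. cos (2 * real n * x)) has_integral
      sin (2 * real n * pi) / (2 * real n) - sin (2 * real n * (- pi)) / (2 * real n)) {-pi..pi}"
    by simp
  moreover have "sin (2 * real n * pi) = 0"
    using sin_npi[of "2 * n"] by simp
  ultimately show ?thesis by simp
qed

definition kekule_integral :: "nat \<Rightarrow> real" where
  "kekule_integral n = integral {-pi..pi} (\<lambda>x. cos (2 * real n * x) / (2 + (sin x)\<^sup>2))"

text \<open>In this form, uniqueness of the integral turns pointwise identities between integrands
  into relations between the values \<open>kekule_integral n\<close>.\<close>

lemma has_integral_kekule_integral:
  "((\<lambda>x. cos (2 * real n * x) / (2 + (sin x)\<^sup>2)) has_integral kekule_integral n) {-pi..pi}"
  unfolding kekule_integral_def
  by (intro integrable_integral integrable_continuous_real continuous_intros)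
     (use two_plus_sin_sq_pos in \<open>auto simp: less_imp_neq[symmetric]\<close>)

lemma kekule_integral_0: "kekule_integral 0 = pi * sqrt (2 / 3)"
  by (simp add: kekule_integral_def integral_inverse_two_plus_sin_sq)

lemma kekule_integral_1: "kekule_integral 1 = 5 * kekule_integral 0 - 4 * pi"
proof -
  have "cos (2 * x) / (2 + (sin x)\<^sup>2) = 5 * (1 / (2 + (sin x)\<^sup>2)) - 2" for x :: real
    using two_plus_sin_sq_pos[of x] unfolding cos_double_sin by (simp add: field_simps)
  moreover have "((\<lambda>x. 5 * (1 / (2 + (sin x)\<^sup>2)) - 2) has_integral 5 * kekule_integral 0 - 4 * pi) {-pi..pi}"
    using has_integral_diff[OF has_integral_mult_right[OF has_integral_kekule_integral[of 0], of 5]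
        has_integral_const_real[of "2::real" "-pi" pi]]
    by simp
  ultimately show ?thesis
    using has_integral_kekule_integral[of 1] by (auto dest: has_integral_unique)
qed

lemma kekule_integral_Suc_Suc:
  "kekule_integral (Suc (Suc n)) = 10 * kekule_integral (Suc n) - kekule_integral n"
proof -
  have "cos (2 * real (Suc (Suc n)) * x) / (2 + (sin x)\<^sup>2) =
      10 * (cos (2 * real (Suc n) * x) / (2 + (sin x)\<^sup>2)) - cos (2 * real n * x) / (2 + (sin x)\<^sup>2)
      - 4 * cos (2 * real (Suc n) * x)" for x
  proof -
    define y where "y = 2 * real (Suc n) * x"
    have args: "2 * real (Suc (Suc n)) * x = y + 2 * x" "2 * real n * x = y - 2 * x"
      by (simp_all add: y_def algebra_simps)
    have "cos (y + 2 * x) + cos (y - 2 * x) = 2 * cos y * (1 - 2 * (sin x)\<^sup>2)"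
      by (simp add: cos_add cos_diff flip: cos_double_sin)
    \<comment> \<open>Rewrites 2 (1 - 2 sin^2 x) as 10 - 4 (2 + sin^2 x), so that division by the
      denominator leaves the pure cosine \<open>4 * cos y\<close>, whose integral is 0 because
      \<open>Suc n\<close> is positive.\<close>
    then have "cos (y + 2 * x) = 10 * cos y - cos (y - 2 * x) - 4 * cos y * (2 + (sin x)\<^sup>2)"
      by (simp add: algebra_simps)
    then show ?thesis
      using two_plus_sin_sq_pos[of x] unfolding args y_def[symmetric]
      by (simp add: diff_divide_distrib)
  qed
  moreover have "((\<lambda>x. 10 * (cos (2 * real (Suc n) * x) / (2 + (sin x)\<^sup>2)) - cos (2 * real n * x) / (2 + (sin x)\<^sup>2)
      - 4 * cos (2 * real (Suc n) * x)) has_integral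
      10 * kekule_integral (Suc n) - kekule_integral n - 4 * 0) {-pi..pi}"
    by (intro has_integral_diff has_integral_mult_right has_integral_kekule_integral
        has_integral_cos_even_multiple) simp
  ultimately show ?thesis
    using has_integral_kekule_integral[of "Suc (Suc n)"] by (auto dest: has_integral_unique)
qed

text \<open>The addition formulas give cos (y + 2 w) + cos (y - 2 w) = 2 cos y cos (2 w), applied at
  the middle angle.\<close>

lemma cos_even_multiple_Suc_Suc:
  fixes w :: complex
  shows "cos (2 * of_nat (Suc (Suc n)) * w) =
    2 * cos (2 * w) * cos (2 * of_nat (Suc n) * w) - cos (2 * of_nat n * w)"
proof -
  define y where "y = 2 * of_nat (Suc n) * w"
  have "2 * of_nat (Suc (Suc n)) * w = y + 2 * w" "2 * of_nat n * w = y - 2 * w"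
    by (simp_all add: y_def algebra_simps)
  then show ?thesis
    unfolding y_def[symmetric] by (simp add: cos_add cos_diff)
qed

text \<open>Over the complex numbers \<open>sin (Arcsin z) = z\<close> for every \<open>z\<close>,
  so sqrt 3 > 1 is no obstacle and 1 - 2 * 3 = -5.\<close>

lemma cos_double_Arcsin_sqrt_3: "cos (2 * Arcsin (complex_of_real (sqrt 3))) = -5"
proof -
  have "(complex_of_real (sqrt 3))\<^sup>2 = 3"
    by (simp flip: of_real_power)
  then show ?thesis
    by (simp add: cos_double_sin)
qed

theorem theorem1:
  fixes n :: nat
  shows "(of_int (kekule_P n) :: complex) =
    complex_of_real (- (1 / pi) * integral {-pi..pi} (\<lambda>x::real. cos (2 * real n * x) / (2 + (sin x)\<^sup>2)))
    + (-1) ^ n * cos (2 * of_nat n * Arcsin (complex_of_real (sqrt 3))) * complex_of_real (sqrt (2 / 3))"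
  unfolding kekule_integral_def[symmetric]
proof (induction n rule: kekule_P.induct)
  case 1
  show ?case
    by (simp add: kekule_integral_0)
next
  case 2
  have "kekule_integral (Suc 0) = 5 * (pi * sqrt (2 / 3)) - 4 * pi"
    using kekule_integral_1 by (simp add: kekule_integral_0)
  \<comment> \<open>The term -5 sqrt (2/3) is cancelled by the cosine term, which is (-1) (-5) sqrt
    (2/3); this leaves 4.\<close>
  then have "- (1 / pi) * kekule_integral (Suc 0) = 4 - 5 * sqrt (2 / 3)"
    by (simp add: field_simps)
  then show ?case
    by (simp only:) (simp add: cos_double_Arcsin_sqrt_3)
next
  case (3 n)
  define t where "t k = cos (2 * of_nat k * Arcsin (complex_of_real (sqrt 3)))" for k :: nat
  \<comment> \<open>The factor \<open>(-1) ^ n\<close> turns the coefficient -10 into the 10 of the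
    recurrence and preserves the sign of the last term.\<close>
  have t: "t (Suc (Suc n)) = -10 * t (Suc n) - t n"
    unfolding t_def by (subst cos_even_multiple_Suc_Suc) (simp add: cos_double_Arcsin_sqrt_3)
  have "(of_int (kekule_P (Suc (Suc n))) :: complex) = 10 * of_int (kekule_P (Suc n)) - of_int (kekule_P n)"
    by simp
  then show ?case
    unfolding "3.IH" t_def[symmetric] t kekule_integral_Suc_Suc
    by (simp add: algebra_simps diff_divide_distrib)
qed

end
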